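(* Let $q=m\cdot10^n>0$, where $m\in[1,10)$ and $n\in\mathbb{Z}$. Let $c_n=\sqrt[3]{10^n}$, let $M=\{(1+0.1j)^3: j=0,1,\dots,16\}$, let $(1+0.1j_* )^3$ be the member of $M$ closest to $m$, and set $\rho_m=1+0.1j_*$. Then $|\rho_m-\sqrt[3]{m}|\le0.05\sqrt[3]{m}$, and $\rho_q=c_n\rho_m$ satisfies $|\rho_q-\sqrt[3]{q}|\le 0.05\sqrt[3]{q}$. In particular, the following seeds $x_0$ can be written in terms of $\rho_m$ and $c_n$: $x_0=\rho_q=c_n\rho_m$ for $x^3-q$; $x_0=0.95\rho_q=0.95c_n\rho_m$ for $x^3+x-q$ ($q\ge3\sqrt2$); and $x_0=-0.95\rho_q=-0.95c_n\rho_m$ for $x^3-x^2+q$ ($q>8$). Moreover, for $P(x)=x^3-q$, the Newton iterates $x_t=N_P(x_{t-1})$ started at $x_0=\rho_q$ satisfy $x_t=c_ny_t$ for all $t\ge0$, where $y_t=N_Q(y_{t-1})$, $Q(y)=y^3-m$ and $y_0=\rho_m$; so to approximate $\sqrt[3]{q}$ it suffices to approximate $\sqrt[3]{m}$ by Newton's method started at $y_0$ and then scale $y_t$ by $c_n$.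
   Context: For a real polynomial $P$, the Newton iteration function is $N_P(x)=x-P(x)/P'(x)$. The seeds listed for the three cubics are the ones the paper uses as approximate zeros (starting points for Newton's method) given any $\rho_q$ with $|\rho_q-\sqrt[3]{q}|\le0.05\sqrt[3]{q}$. *)

theory Defs
  imports Complex_Main "HOL-Computational_Algebra.Polynomial"
begin

definition newton_map :: "real poly \<Rightarrow> real \<Rightarrow> real" where
  "newton_map P x = x - poly P x / poly (pderiv P) x"

definition cube_grid :: "real set" where
  "cube_grid = (\<lambda>j. (1 + 0.1 * real j) ^ 3) ` {0..16::nat}"

(* newton_seed rho P x0: given a 5%-approximation rho of the real cube root of q,
   x0 is the starting point prescribed for the cubic P; the three cubics are
   x^3 - q, x^3 + x - q and x^3 - x^2 + q. The predicate only records this prescription;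
   it says nothing about the speed of convergence from x0. *)
inductive newton_seed :: "real \<Rightarrow> real poly \<Rightarrow> real \<Rightarrow> bool" where
  pure: "0 < q \<Longrightarrow> \<bar>\<rho> - root 3 q\<bar> \<le> 0.05 * root 3 q
    \<Longrightarrow> newton_seed \<rho> [:- q, 0, 0, 1:] \<rho>"
| linear: "q \<ge> 3 * sqrt 2 \<Longrightarrow> \<bar>\<rho> - root 3 q\<bar> \<le> 0.05 * root 3 q
    \<Longrightarrow> newton_seed \<rho> [:- q, 1, 0, 1:] (0.95 * \<rho>)"
| quadratic: "q > 8 \<Longrightarrow> \<bar>\<rho> - root 3 q\<bar> \<le> 0.05 * root 3 q
    \<Longrightarrow> newton_seed \<rho> [:q, 0, - 1, 1:] (- 0.95 * \<rho>)"

end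

theory Submission
  imports Defs
begin

text \<open>
  Two neighbouring grid points \<open>a\<^sup>3 < b\<^sup>3\<close> with \<open>b = a + 0.1\<close> compete on either side of
  \<open>(a\<^sup>3 + b\<^sup>3) / 2\<close>. If the smaller one wins, then \<open>m \<le> (a\<^sup>3 + b\<^sup>3) / 2 \<le> (a / 0.95)\<^sup>3\<close>, since
  \<open>a \<ge> 1\<close>; the worst case \<open>a = 1\<close> is nearly tight (1.1655 against 1.1663). If the larger one
  wins, convexity of the cube gives \<open>m \<ge> (b - 0.05)\<^sup>3\<close>, and \<open>0.05 \<le> 0.05 * root 3 m\<close>. Everything
  else is homogeneity: scaling by \<open>c\<close> carries \<open>m\<close> to \<open>q = c\<^sup>3 * m\<close> and commutes with the Newton maps.
\<close>

text \<open>For \<open>a\<close> \<ge> 1 every lower power in the expanded left side is at most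
  \<open>a ^ 3\<close>, so that side is at most \<open>2.331 * a ^ 3\<close>, while 2 / 0.95^3 =
  16000 / 6859 > 2.332.\<close>

lemma cube_midpoint_le:
  fixes a :: real
  assumes "1 \<le> a"
  shows "a ^ 3 + (a + 0.1) ^ 3 \<le> 2 * (a / 0.95) ^ 3"
proof -
  have "a ^ 2 \<le> a ^ 3" "a \<le> a ^ 3" "1 \<le> a ^ 3"
    using assms power_increasing[of 2 3 a] power_increasing[of 1 3 a] by simp_all
  moreover have "(a + 0.1) ^ 3 = a ^ 3 + 0.3 * a ^ 2 + 0.03 * a + 0.001"
    by (simp add: power2_eq_square power3_eq_cube field_simps)
  moreover have "2 * (a / 0.95) ^ 3 = 16000 / 6859 * a ^ 3"
    by (simp add: power_divide power3_eq_cube)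
  ultimately show ?thesis by simp
qed

text \<open>Midpoint convexity of the cube, with gap exactly \<open>6 * (a - d) * d ^ 2\<close>; its
  sign is that of the midpoint \<open>a - d\<close>.\<close>

lemma cube_midpoint_ge:
  fixes a d :: real
  assumes "d \<le> a"
  shows "2 * (a - d) ^ 3 \<le> a ^ 3 + (a - 2 * d) ^ 3"
proof -
  have "a ^ 3 + (a - 2 * d) ^ 3 - 2 * (a - d) ^ 3 = 6 * (a - d) * d ^ 2"
    by (simp add: power2_eq_square power3_eq_cube algebra_simps)
  moreover have "0 \<le> 6 * (a - d) * d ^ 2" using assms by simp
  ultimately show ?thesis by linarith
qed

lemma nearest_cube_grid_root:
  fixes m :: real and j :: nat
  assumes m: "1 \<le> m" "m < 10" and j: "j \<le> 16"
    and near: "\<forall>\<mu>\<in>cube_grid. \<bar>(1 + 0.1 * real j) ^ 3 - m\<bar> \<le> \<bar>\<mu> - m\<bar>"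
  shows "\<bar>(1 + 0.1 * real j) - root 3 m\<bar> \<le> 0.05 * root 3 m"
proof -
  define a where "a = 1 + 0.1 * real j"
  define r where "r = root 3 m"
  have r3: "r ^ 3 = m" using m unfolding r_def by (simp add: real_root_pow_pos2)
  have r1: "1 \<le> r" using m unfolding r_def by simp
  have a1: "1 \<le> a" unfolding a_def by simp
  have nearest: "\<bar>a ^ 3 - m\<bar> \<le> \<bar>(1 + 0.1 * real k) ^ 3 - m\<bar>" if "k \<le> 16" for k
    using near that unfolding a_def cube_grid_def by fastforce
  \<comment> \<open>The half \<open>r - a \<le> 0.05 * r\<close> of the bound amounts to
    \<open>r \<le> a / 0.95\<close>, compared here through cubes.\<close>
  have "r ^ 3 \<le> (a / 0.95) ^ 3"
  proof (cases "j < 16")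
    case True
    have "1 + 0.1 * real (Suc j) = a + 0.1" unfolding a_def by (simp add: field_simps)
    hence "\<bar>a ^ 3 - m\<bar> \<le> \<bar>(a + 0.1) ^ 3 - m\<bar>"
      using nearest[of "Suc j"] True by simp
    moreover have "a ^ 3 < (a + 0.1) ^ 3"
      using a1 by (intro power_strict_mono) auto
    ultimately have "2 * m \<le> a ^ 3 + (a + 0.1) ^ 3" by linarith
    thus ?thesis using cube_midpoint_le[OF a1] r3 by linarith
  next
    \<comment> \<open>At the top of the grid there is no larger competitor, but (2.6 / 0.95)^3 is
      about 20.5, well above \<open>m\<close>.\<close>
    case False
    hence "a = 2.6" using j unfolding a_def by simp
    hence "10 \<le> (a / 0.95) ^ 3" by (simp only:) (simp add: power3_eq_cube)
    thus ?thesis using m r3 by linarith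
  qed
  hence upper: "r \<le> a / 0.95"
    using a1 by (subst (asm) power_mono_iff) (use r1 in auto)
  have lower: "a - 0.05 * r \<le> r"
  proof (cases "j = 0")
    \<comment> \<open>No smaller competitor exists (and \<open>j - 1\<close> would truncate to 0),
      but here \<open>a = 1\<close>, which is at most \<open>r\<close>.\<close>
    case True
    thus ?thesis using r1 unfolding a_def by simp
  next
    case False
    \<comment> \<open>The grid step is written \<open>2 * 0.05\<close> to fit the convexity lemma
      with \<open>d = 0.05\<close>.\<close>
    hence "1 + 0.1 * real (j - 1) = a - 2 * 0.05"
      unfolding a_def by (simp add: of_nat_diff field_simps)
    hence "\<bar>a ^ 3 - m\<bar> \<le> \<bar>(a - 2 * 0.05) ^ 3 - m\<bar>"
      using nearest[of "j - 1"] j by simp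
    moreover have "(a - 2 * 0.05) ^ 3 < a ^ 3"
      using a1 by (intro power_strict_mono) auto
    ultimately have "a ^ 3 + (a - 2 * 0.05) ^ 3 \<le> 2 * m" by linarith
    moreover have "2 * (a - 0.05) ^ 3 \<le> a ^ 3 + (a - 2 * 0.05) ^ 3"
      using a1 by (intro cube_midpoint_ge) simp
    ultimately have "(a - 0.05) ^ 3 \<le> r ^ 3"
      using r3 by linarith
    hence "a - 0.05 \<le> r"
      by (subst (asm) power_mono_iff) (use r1 a1 in auto)
    thus ?thesis using r1 by simp
  qed
  have "\<bar>a - r\<bar> \<le> 0.05 * r" using upper lower by (simp add: abs_if)
  thus ?thesis unfolding a_def r_def .
qed

lemma poly_pderiv_pure_cubic: "poly (pderiv [:- m, 0, 0, 1:]) y = 3 * y ^ 2"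
  for m y :: real
  by (simp add: pderiv_pCons power2_eq_square)

text \<open>In this form positivity of \<open>m\<close> and \<open>y\<close> visibly passes to the
  next iterate.\<close>

lemma newton_map_pure_cubic:
  fixes m y :: real
  assumes "y \<noteq> 0"
  shows "newton_map [:- m, 0, 0, 1:] y = (2 * y ^ 3 + m) / (3 * y ^ 2)"
  using assms unfolding newton_map_def poly_pderiv_pure_cubic
  by (simp add: field_simps power2_eq_square power3_eq_cube)

text \<open>In the closed form the numerator scales by \<open>c ^ 3\<close> and the denominator by
  \<open>c ^ 2\<close>, leaving one factor \<open>c\<close>.\<close>

lemma newton_map_pure_cubic_scale:
  fixes c m y :: real
  assumes "c \<noteq> 0" "y \<noteq> 0"
  shows "newton_map [:- (m * c ^ 3), 0, 0, 1:] (c * y) = c * newton_map [:- m, 0, 0, 1:] y"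
  using assms
  by (simp add: newton_map_pure_cubic field_simps power2_eq_square power3_eq_cube)

theorem proposition3:
  fixes q m c \<rho>m \<rho>q :: real and n :: int and j :: nat and P Q :: "real poly"
    and x y :: "nat \<Rightarrow> real"
  assumes "q = m * 10 powi n" and "q > 0" and "m \<in> {1..<10}"
    and "c = root 3 (10 powi n)"
    and "j \<in> {0..16}"
    and "\<forall>\<mu>\<in>cube_grid. \<bar>(1 + 0.1 * real j) ^ 3 - m\<bar> \<le> \<bar>\<mu> - m\<bar>"
    and "\<rho>m = 1 + 0.1 * real j"
    and "\<rho>q = c * \<rho>m"
    and "P = [:- q, 0, 0, 1:]" and "Q = [:- m, 0, 0, 1:]"
    and "x 0 = \<rho>q" and "\<forall>t. x (Suc t) = newton_map P (x t)"
    and "y 0 = \<rho>m" and "\<forall>t. y (Suc t) = newton_map Q (y t)"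
  shows "\<bar>\<rho>m - root 3 m\<bar> \<le> 0.05 * root 3 m
    \<and> \<bar>\<rho>q - root 3 q\<bar> \<le> 0.05 * root 3 q
    \<and> (newton_seed \<rho>q [:- q, 0, 0, 1:] \<rho>q \<and> \<rho>q = c * \<rho>m)
    \<and> (q \<ge> 3 * sqrt 2 \<longrightarrow>
         newton_seed \<rho>q [:- q, 1, 0, 1:] (0.95 * \<rho>q) \<and> 0.95 * \<rho>q = 0.95 * c * \<rho>m)
    \<and> (q > 8 \<longrightarrow>
         newton_seed \<rho>q [:q, 0, - 1, 1:] (- 0.95 * \<rho>q) \<and> - 0.95 * \<rho>q = - 0.95 * c * \<rho>m)
    \<and> (\<forall>t. poly (pderiv P) (x t) \<noteq> 0 \<and> poly (pderiv Q) (y t) \<noteq> 0)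
    \<and> (\<forall>t. x t = c * y t)
    \<and> (\<forall>t. \<bar>c * y t - root 3 q\<bar> = c * \<bar>y t - root 3 m\<bar>)"
proof -
  have m: "1 \<le> m" "m < 10" using assms(3) by auto
  have c0: "c > 0" using assms(4) by simp
  have qc: "q = m * c ^ 3" using assms(1,4) by (simp add: real_root_pow_pos2)
  have rq: "root 3 q = c * root 3 m"
    using qc c0 by (simp add: real_root_mult real_root_power_cancel)
  have A: "\<bar>\<rho>m - root 3 m\<bar> \<le> 0.05 * root 3 m"
    using nearest_cube_grid_root[OF m _ assms(6)] assms(5,7) by simp
  \<comment> \<open>Used twice: \<open>u = \<rho>m\<close> transfers the 5% bound to
    \<open>q\<close>, and \<open>u = y t\<close> gives the error identity.\<close>
  have scale: "\<bar>c * u - root 3 q\<bar> = c * \<bar>u - root 3 m\<bar>" for u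
    using c0 unfolding rq by (simp add: abs_mult flip: right_diff_distrib)
  have B: "\<bar>\<rho>q - root 3 q\<bar> \<le> 0.05 * root 3 q"
    using A c0 unfolding assms(8) scale by (simp add: rq)
  have y0: "y t > 0" for t
  proof (induction t)
    case 0
    show ?case using assms(7,13) by simp
  next
    case (Suc t)
    thus ?case using m assms(10,14) by (simp add: newton_map_pure_cubic add_pos_pos)
  qed
  have xy: "x t = c * y t" for t
  proof (induction t)
    case 0
    show ?case using assms(8,11,13) by simp
  next
    case (Suc t)
    have "x (Suc t) = newton_map [:- (m * c ^ 3), 0, 0, 1:] (c * y t)"
      using Suc assms(9,12) qc by simp
    also have "\<dots> = c * y (Suc t)"
      using newton_map_pure_cubic_scale[of c "y t" m] c0 y0[of t] assms(10,14) by simp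
    finally show ?case .
  qed
  \<comment> \<open>Division by zero yields 0 in HOL, so this certifies that every iterate comes
    from a genuine Newton step.\<close>
  have "poly (pderiv P) (x t) \<noteq> 0 \<and> poly (pderiv Q) (y t) \<noteq> 0" for t
    unfolding assms(9,10) poly_pderiv_pure_cubic xy using c0 y0[of t] by simp
  moreover have "newton_seed \<rho>q [:- q, 0, 0, 1:] \<rho>q"
    by (rule newton_seed.pure[OF assms(2) B])
  moreover have "3 * sqrt 2 \<le> q \<longrightarrow> newton_seed \<rho>q [:- q, 1, 0, 1:] (0.95 * \<rho>q)"
    using newton_seed.linear[OF _ B] by blast
  moreover have "8 < q \<longrightarrow> newton_seed \<rho>q [:q, 0, - 1, 1:] (- 0.95 * \<rho>q)"
    using newton_seed.quadratic[OF _ B] by blast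
  moreover have "0.95 * \<rho>q = 0.95 * c * \<rho>m" "- 0.95 * \<rho>q = - 0.95 * c * \<rho>m"
    unfolding assms(8) by simp_all
  ultimately show ?thesis
    using A B xy scale assms(8) by blast
qed

end
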